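(* Consider an instance of the minimum crossing contra-polymatroid intersection problem: a finite ground set $E$, two supermodular functions $r_1,r_2:2^E\to\mathbb{Z}$, costs $c:E\to\mathbb{R}_{\ge0}$, and subsets $\{E_i\}_{i\in I}$ of $E$ with bounds $\{b_i\}_{i\in I}$. Let $\Delta=\max_{e\in E}|\{i\in I: e\in E_i\}|$. Then any optimal basic (extreme point) solution $x^*$ of the linear relaxation $\min\{c^Tx : x(S)\ge\max\{r_1(S),r_2(S)\}\ \forall S\subseteq E;\ x(E_i)\le b_i\ \forall i\in I;\ 0\le x_e\le1\ \forall e\in E\}$ can be rounded into an integral solution $\hat x\in\{0,1\}^E$ such that $\hat x(S)\ge\max\{r_1(S),r_2(S)\}$ for all $S\subseteq E$, $\hat x(E_i)\le 2b_i+\Delta-1$ for all $i\in I$, and $c^T\hat x\le 2c^Tx^*$.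
   Context: For $x\in\mathbb{R}^E$ and $A\subseteq E$, $x(A)=\sum_{e\in A}x_e$. A function $r:2^E\to\mathbb{Z}$ is supermodular if $r(A)+r(B)\le r(A\cap B)+r(A\cup B)$ for all $A,B\subseteq E$. The integer problem asks to minimize $c^Tx$ over $x\in\{0,1\}^E$ with $x(S)\ge\max\{r_1(S),r_2(S)\}$ for all $S\subseteq E$ and $x(E_i)\le b_i$ for all $i\in I$.
   Formalization: The bounds b_i are taken to be integers (for real b_i the claim fails, e.g. three singletons with b=(0.3,0.3,0.4) and r(E)=1), and if I is nonempty, Δ≥1 is assumed (if all E_i are empty and some b_i=0, the bound would read 0≤-1). *)

theory Defs
  imports "HOL-Analysis.Analysis"
begin

definition supermodular :: "('e set \<Rightarrow> int) \<Rightarrow> bool" where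
  "supermodular r \<longleftrightarrow> (\<forall>A B. r A + r B \<le> r (A \<inter> B) + r (A \<union> B))"

definition weight :: "real ^ 'e::finite \<Rightarrow> 'e set \<Rightarrow> real" where
  "weight x A = (\<Sum>e\<in>A. x $ e)"

definition covers :: "('e::finite set \<Rightarrow> int) \<Rightarrow> ('e set \<Rightarrow> int) \<Rightarrow> real ^ 'e \<Rightarrow> bool" where
  "covers r1 r2 x \<longleftrightarrow> (\<forall>S. weight x S \<ge> of_int (max (r1 S) (r2 S)))"

text \<open>The ground set is the universe of the finite type \<open>'e\<close>. It is thus nonempty, so that the
  maximum in \<open>max_degree\<close> is over a nonempty set; the count there is meaningful for finite \<open>I\<close>.\<close>

definition max_degree :: "'i set \<Rightarrow> ('i \<Rightarrow> 'e::finite set) \<Rightarrow> nat" where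
  "max_degree I E = Max (range (\<lambda>e. card {i \<in> I. e \<in> E i}))"

definition lp_feasible ::
  "('e::finite set \<Rightarrow> int) \<Rightarrow> ('e set \<Rightarrow> int) \<Rightarrow> 'i set \<Rightarrow> ('i \<Rightarrow> 'e set) \<Rightarrow> ('i \<Rightarrow> int) \<Rightarrow> (real ^ 'e) set"
where
  "lp_feasible r1 r2 I E b =
    {x. covers r1 r2 x \<and> (\<forall>i\<in>I. weight x (E i) \<le> of_int (b i)) \<and> (\<forall>e. 0 \<le> x $ e \<and> x $ e \<le> 1)}"

end

theory Submission
  imports Defs
begin

text \<open>Iterative rounding. At an optimal extreme point of the current linear program, delete elements
  with value 0, round up elements with value at least 1/2 (relaxing cost and bounds by half of what
  they are charged), and drop a bound \<open>i\<close> once even taking all remaining elements keeps it below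
  \<open>2 * b i + \<Delta>\<close>. If none of these applies, all values on the set \<open>F\<close> of free elements lie strictly
  between 0 and 1/2. Uncrossing bounds the rank of the tight covering constraints by less than
  \<open>2 * x(F)\<close>, so with the set \<open>K\<close> of tight bounds \<open>|F| - 2 * x(F) < |K|\<close>. On the other hand each
  tight bound has \<open>|E i \<inter> F| - 2 * x(E i \<inter> F) \<ge> \<Delta>\<close>, and summing over \<open>K\<close>, where every element is
  counted at most \<open>\<Delta>\<close> times, gives \<open>\<Delta> * |K| \<le> \<Delta> * (|F| - 2 * x(F))\<close>, a contradiction.\<close>

section \<open>Indicator vectors, weights and lattices of sets\<close>

definition ind_vec :: "'e::finite set \<Rightarrow> real ^ 'e" where
  "ind_vec A = (\<chi> e. if e \<in> A then 1 else 0)"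

lemma ind_vec_nth [simp]: "ind_vec A $ e = (if e \<in> A then 1 else 0)"
  by (simp add: ind_vec_def)

lemma inner_ind_vec: "x \<bullet> ind_vec A = weight x A"
  by (simp add: inner_vec_def weight_def if_distrib sum.If_cases cong: if_cong)

lemma weight_empty [simp]: "weight x {} = 0"
  by (simp add: weight_def)

lemma weight_Un_Int: "weight x (A \<union> B) + weight x (A \<inter> B) = weight x A + weight x B"
  unfolding weight_def by (rule sum.union_inter) auto

lemma weight_add_scaleR: "weight (x + t *\<^sub>R d) A = weight x A + t * weight d A"
  by (simp add: weight_def sum.distrib sum_distrib_left)

lemma weight_mono: "A \<subseteq> B \<Longrightarrow> (\<And>e. e \<in> B \<Longrightarrow> 0 \<le> x $ e) \<Longrightarrow> weight x A \<le> weight x B"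
  unfolding weight_def by (rule sum_mono2) auto

lemma weight_strict_mono:
  assumes "A \<subset> B" "\<And>e. e \<in> B \<Longrightarrow> 0 < x $ e"
  shows "weight x A < weight x B"
proof -
  obtain e where "e \<in> B" "e \<notin> A" using assms(1) by blast
  then show ?thesis
    unfolding weight_def using assms
    by (intro sum_strict_mono2[of B A e]) (auto simp: less_imp_le)
qed

lemma weight_ind_vec: "weight (ind_vec P) A = real (card (A \<inter> P))"
  by (simp add: weight_def sum.If_cases)

lemma weight_Int_support:
  "(\<And>e. e \<notin> F \<Longrightarrow> d $ e = 0) \<Longrightarrow> weight d (A \<inter> F) = weight d A"
  unfolding weight_def by (rule sum.mono_neutral_left) auto

text \<open>For \<open>M\<close> maximal among the proper subsets of the top set \<open>U\<close> that lie in the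
  lattice, each member lies below \<open>M\<close> or joins with \<open>M\<close> to \<open>U\<close>. Adding \<open>U\<close> to the sets for the
  sublattice below \<open>M\<close> then costs one set, while the integral weight of the top grows by at
  least one.\<close>

lemma set_lattice_span:
  fixes x :: "real ^ 'e::finite" and L :: "'e set set"
  assumes "{} \<in> L"
    and "\<And>A B. A \<in> L \<Longrightarrow> B \<in> L \<Longrightarrow> A \<union> B \<in> L"
    and "\<And>A B. A \<in> L \<Longrightarrow> B \<in> L \<Longrightarrow> A \<inter> B \<in> L"
    and "U \<in> L" and "\<And>A. A \<in> L \<Longrightarrow> A \<subseteq> U"
    and "\<And>e. e \<in> U \<Longrightarrow> 0 < x $ e"
    and "\<And>A. A \<in> L \<Longrightarrow> weight x A \<in> \<int>"
  shows "\<exists>C. real (card C) \<le> weight x U \<and> (U \<noteq> {} \<longrightarrow> U \<in> C) \<and>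
           ind_vec ` L \<subseteq> span (ind_vec ` C)"
  using finite[of U] assms
proof (induction U arbitrary: L rule: finite_psubset_induct)
  case (psubset U)
  show ?case
  proof (cases "U = {}")
    case True
    have "ind_vec {} = (0 :: real ^ 'e)" by (simp add: vec_eq_iff)
    then have "ind_vec ` L \<subseteq> span (ind_vec ` {})"
      using psubset.prems(5) True by auto
    then show ?thesis using True by (intro exI[of _ "{}"]) simp
  next
    case False
    let ?S = "{A \<in> L. A \<subset> U}"
    have "finite ?S" "?S \<noteq> {}" using psubset.prems(1) False by auto
    then obtain M where M: "M \<in> ?S" and Mmax: "\<And>A. A \<in> ?S \<Longrightarrow> M \<subseteq> A \<Longrightarrow> M = A"
      using finite_has_maximal[of ?S] by metis
    let ?L = "{A \<in> L. A \<subseteq> M}"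
    have "\<exists>C. real (card C) \<le> weight x M \<and> (M \<noteq> {} \<longrightarrow> M \<in> C) \<and>
           ind_vec ` ?L \<subseteq> span (ind_vec ` C)"
      using M psubset.prems by (intro psubset.IH) auto
    then obtain C where C: "real (card C) \<le> weight x M"
      "ind_vec ` ?L \<subseteq> span (ind_vec ` C)" by blast
    have "weight x M < weight x U"
      using M psubset.prems(6) by (intro weight_strict_mono) auto
    moreover have "weight x M \<in> \<int>" "weight x U \<in> \<int>" using M psubset.prems by auto
    ultimately have step: "weight x M + 1 \<le> weight x U"
      by (auto elim!: Ints_cases)
    let ?C = "insert U C"
    have "real (card ?C) \<le> weight x U"
      using C(1) step card_insert_le_m1[of "Suc (card C)" C U] by auto
    moreover have "ind_vec A \<in> span (ind_vec ` ?C)" if "A \<in> L" for A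
    proof (cases "A \<subseteq> M")
      case True
      then show ?thesis using that C(2) span_mono[of "ind_vec ` C" "ind_vec ` ?C"] by blast
    next
      case A: False
      have "A \<union> M = U"
        using Mmax[of "A \<union> M"] A M that psubset.prems(2,5) by blast
      \<comment> \<open>Modularity of indicator vectors for the pair \<open>A\<close>,
        \<open>M\<close>. Both \<open>M\<close> and \<open>A \<inter> M\<close> lie below
        \<open>M\<close> and are spanned already, so \<open>U\<close> is the only new
        generator.\<close>
      then have eq: "ind_vec A = ind_vec U - ind_vec M + ind_vec (A \<inter> M)"
        by (auto simp: vec_eq_iff)
      have "M \<in> ?L" "A \<inter> M \<in> ?L" using M that psubset.prems(3) by auto
      then have "ind_vec M \<in> span (ind_vec ` ?C)" "ind_vec (A \<inter> M) \<in> span (ind_vec ` ?C)"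
        using C(2) span_mono[of "ind_vec ` C" "ind_vec ` ?C"] by blast+
      moreover have "ind_vec U \<in> span (ind_vec ` ?C)" by (simp add: span_base)
      ultimately show ?thesis unfolding eq by (intro span_add span_diff)
    qed
    ultimately show ?thesis by (intro exI[of _ ?C]) auto
  qed
qed

section \<open>Tight sets of a supermodular function\<close>

text \<open>Weight is modular, so supermodularity bounds the sum of the weights of union and
  intersection by the sum of their requirements. As neither weight is below its requirement, both
  are equal to it.\<close>

lemma tight_lattice:
  assumes "supermodular r" and "\<And>S. of_int (r S) \<le> weight x S"
    and "weight x A = of_int (r A)" "weight x B = of_int (r B)"
  shows "weight x (A \<union> B) = of_int (r (A \<union> B))" "weight x (A \<inter> B) = of_int (r (A \<inter> B))"
proof -
  have "real_of_int (r A + r B) \<le> real_of_int (r (A \<inter> B) + r (A \<union> B))"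
    using assms(1) unfolding supermodular_def of_int_le_iff by blast
  then have "weight x (A \<union> B) + weight x (A \<inter> B) \<le> of_int (r (A \<inter> B)) + of_int (r (A \<union> B))"
    using assms(3,4) weight_Un_Int[of x A B] by simp
  then show "weight x (A \<union> B) = of_int (r (A \<union> B))" "weight x (A \<inter> B) = of_int (r (A \<inter> B))"
    using assms(2)[of "A \<union> B"] assms(2)[of "A \<inter> B"] by linarith+
qed

text \<open>The traces on \<open>F\<close> of the tight sets form a lattice with integral weights,
  to which \<open>set_lattice_span\<close> applies. The top \<open>U\<close> is kept in the
  conclusion so that two such families can later be seen to share a set.\<close>

lemma tight_span:
  fixes x :: "real ^ 'e::finite"
  assumes "supermodular r" and "\<And>S. of_int (r S) \<le> weight x S"
    and P: "\<And>e. e \<in> P \<Longrightarrow> x $ e = 1" and off: "\<And>e. e \<notin> F \<union> P \<Longrightarrow> x $ e = 0"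
    and "F \<inter> P = {}" and pos: "\<And>e. e \<in> F \<Longrightarrow> 0 < x $ e"
  shows "\<exists>U C. U \<subseteq> F \<and> real (card C) \<le> weight x U \<and> (U \<noteq> {} \<longrightarrow> U \<in> C) \<and>
           (\<forall>S. weight x S = of_int (r S) \<longrightarrow> ind_vec (S \<inter> F) \<in> span (ind_vec ` C))"
proof -
  let ?T = "{S. weight x S = of_int (r S)}"
  \<comment> \<open>The empty set is added so that there is a top member even if no set is
    tight.\<close>
  let ?L = "insert {} ((\<lambda>S. S \<inter> F) ` ?T)"
  have un: "A \<union> B \<in> ?L" if "A \<in> ?L" "B \<in> ?L" for A B
  proof -
    have "(A \<inter> F) \<union> (B \<inter> F) \<in> ?L" if "A \<in> ?T" "B \<in> ?T" for A B
      using tight_lattice(1)[of r x A B] that assms(1,2)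
      by (intro insertI2 image_eqI[of _ _ "A \<union> B"]) auto
    then show ?thesis using that by auto
  qed
  have int: "A \<inter> B \<in> ?L" if "A \<in> ?L" "B \<in> ?L" for A B
  proof -
    have "(A \<inter> F) \<inter> (B \<inter> F) \<in> ?L" if "A \<in> ?T" "B \<in> ?T" for A B
      using tight_lattice(2)[of r x A B] that assms(1,2)
      by (intro insertI2 image_eqI[of _ _ "A \<inter> B"]) auto
    then show ?thesis using that by auto
  qed
  have ints: "weight x A \<in> \<int>" if "A \<in> ?L" for A
  proof -
    have "weight x (S \<inter> F) \<in> \<int>" if "S \<in> ?T" for S
    proof -
      \<comment> \<open>Outside \<open>F\<close> all values are 0 or 1, so the weight of the trace
        differs from the integer \<open>r S\<close> by a cardinality.\<close>
      have "weight x S = weight x (S \<inter> F) + weight x (S \<inter> P)"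
      proof -
        have "weight x S = weight x (S \<inter> (F \<union> P))"
          using off by (intro weight_Int_support[symmetric]) auto
        also have "\<dots> = weight x (S \<inter> F) + weight x (S \<inter> P)"
          using weight_Un_Int[of x "S \<inter> F" "S \<inter> P"] assms(5)
          by (simp add: Int_Un_distrib Int_assoc Int_left_commute)
        finally show ?thesis .
      qed
      moreover have "weight x (S \<inter> P) = real (card (S \<inter> P))"
        using P by (simp add: weight_def)
      ultimately have "weight x (S \<inter> F) = of_int (r S - int (card (S \<inter> P)))"
        using that by simp
      then show ?thesis by simp
    qed
    then show ?thesis using that by auto
  qed
  have top: "\<Union>?L \<in> ?L"
  proof -
    have "\<Union>X \<in> ?L" if "finite X" "X \<subseteq> ?L" for X
      using that
    proof (induction X rule: finite_induct)
      case (insert A X)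
      then show ?case unfolding Union_insert by (intro un) auto
    qed simp
    from this[OF finite subset_refl] show ?thesis .
  qed
  have "\<exists>C. real (card C) \<le> weight x (\<Union>?L) \<and> (\<Union>?L \<noteq> {} \<longrightarrow> \<Union>?L \<in> C) \<and>
           ind_vec ` ?L \<subseteq> span (ind_vec ` C)"
  proof (rule set_lattice_span[OF _ un int top _ _ ints])
    show "A \<subseteq> \<Union>?L" if "A \<in> ?L" for A using that by (rule Union_upper)
    show "0 < x $ e" if "e \<in> \<Union>?L" for e using that by (auto intro: pos)
  qed simp_all
  then obtain C where "real (card C) \<le> weight x (\<Union>?L)" "\<Union>?L \<noteq> {} \<longrightarrow> \<Union>?L \<in> C"
           "ind_vec ` ?L \<subseteq> span (ind_vec ` C)" by blast
  then show ?thesis by (intro exI[of _ "\<Union>?L"] exI[of _ C]) auto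
qed

section \<open>The residual linear program\<close>

text \<open>Only elements of value at least 1/2 are rounded up, so relaxing \<open>b i\<close> by 1/2 per rounded
  element keeps the current point feasible.\<close>

definition residual ::
  "('e::finite set \<Rightarrow> int) \<Rightarrow> ('e set \<Rightarrow> int) \<Rightarrow> ('i \<Rightarrow> 'e set) \<Rightarrow> ('i \<Rightarrow> int) \<Rightarrow>
   'e set \<Rightarrow> 'e set \<Rightarrow> 'i set \<Rightarrow> (real ^ 'e) set"
where
  "residual r1 r2 E b F P J =
    {x. covers r1 r2 x \<and> (\<forall>i\<in>J. weight x (E i) \<le> of_int (b i) + real (card (E i \<inter> P)) / 2) \<and>
        (\<forall>e. 0 \<le> x $ e \<and> x $ e \<le> 1) \<and> (\<forall>e\<in>P. x $ e = 1) \<and> (\<forall>e. e \<notin> F \<union> P \<longrightarrow> x $ e = 0)}"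

lemma covers_alt:
  "covers r1 r2 x \<longleftrightarrow> (\<forall>S. of_int (r1 S) \<le> weight x S) \<and> (\<forall>S. of_int (r2 S) \<le> weight x S)"
  unfolding covers_def of_int_max max.bounded_iff by blast

lemma covers_mono:
  assumes "covers r1 r2 x" "\<And>e. x $ e \<le> y $ e"
  shows "covers r1 r2 y"
proof -
  have "weight x S \<le> weight y S" for S
    unfolding weight_def using assms(2) by (rule sum_mono)
  then show ?thesis using assms(1) unfolding covers_def by (meson order_trans)
qed

text \<open>The polytope is an intersection of closed half-spaces and hyperplanes inside the unit
  cube. Compactness and convexity are what the existence of extreme points requires.\<close>

lemma compact_convex_residual:
  "compact (residual r1 r2 E b F P J)" "convex (residual r1 r2 E b F P J)"
proof -
  let ?H = "(\<Inter>S. {x. ind_vec S \<bullet> x \<ge> of_int (r1 S)}) \<inter> (\<Inter>S. {x. ind_vec S \<bullet> x \<ge> of_int (r2 S)})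
    \<inter> (\<Inter>i\<in>J. {x. ind_vec (E i) \<bullet> x \<le> of_int (b i) + real (card (E i \<inter> P)) / 2})
    \<inter> (\<Inter>e. {x. axis e 1 \<bullet> x \<ge> 0}) \<inter> (\<Inter>e. {x. axis e 1 \<bullet> x \<le> 1})
    \<inter> (\<Inter>e\<in>P. {x. axis e 1 \<bullet> x = 1}) \<inter> (\<Inter>e\<in>-(F \<union> P). {x. axis e 1 \<bullet> x = 0})"
  have eq: "residual r1 r2 E b F P J = ?H"
    by (auto simp: residual_def covers_alt inner_commute[of "ind_vec _"] inner_ind_vec inner_axis')
  show "convex (residual r1 r2 E b F P J)"
    unfolding eq by (intro convex_Int convex_INT convex_halfspace_ge convex_halfspace_le convex_hyperplane)
  have "closed (residual r1 r2 E b F P J)"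
    unfolding eq by (intro closed_Int closed_INT ballI closed_halfspace_ge closed_halfspace_le closed_hyperplane)
  moreover have "residual r1 r2 E b F P J \<subseteq> cbox 0 1"
    by (auto simp: residual_def mem_box_cart)
  ultimately show "compact (residual r1 r2 E b F P J)"
    using bounded_cbox bounded_subset compact_eq_bounded_closed by blast
qed

section \<open>Existence and perturbation of extreme points\<close>

text \<open>The minimizers of the cost form a nonempty compact face. It has an extreme point, and
  extreme points of a face are extreme in the whole set.\<close>

lemma exists_optimal_extreme_point:
  fixes Q :: "'a::euclidean_space set"
  assumes "compact Q" "convex Q" "y \<in> Q"
  shows "\<exists>x. x extreme_point_of Q \<and> c \<bullet> x \<le> c \<bullet> y"
proof -
  have "continuous_on Q (\<lambda>x. c \<bullet> x)" by (intro continuous_intros)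
  then obtain z where z: "z \<in> Q" "\<And>w. w \<in> Q \<Longrightarrow> c \<bullet> z \<le> c \<bullet> w"
    using continuous_attains_inf[of Q] assms by blast
  let ?Fc = "Q \<inter> {x. c \<bullet> x = c \<bullet> z}"
  have face: "?Fc face_of Q"
    using face_of_Int_supporting_hyperplane_ge[OF assms(2)] z(2) by blast
  have "compact ?Fc" "convex ?Fc" "?Fc \<noteq> {}"
    using z assms by (auto intro!: compact_Int_closed closed_hyperplane convex_Int convex_hyperplane)
  then obtain x where "x extreme_point_of ?Fc"
    using extreme_point_exists_convex by blast
  then have "x extreme_point_of Q" "x \<in> ?Fc"
    using extreme_point_of_face[OF face] by auto
  then show ?thesis using z(2)[OF assms(3)] by auto
qed

text \<open>A slack constraint survives small steps by continuity, and a tight one does not change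
  along a direction of slope 0. The filter \<open>nhds 0\<close> covers steps of both signs.\<close>

lemma eventually_affine_le:
  fixes g :: real
  assumes "g \<le> u" "g = u \<Longrightarrow> h = 0"
  shows "eventually (\<lambda>t. g + t * h \<le> u) (nhds 0)"
proof (cases "g = u")
  case False
  have "((\<lambda>t. g + t * h) \<longlongrightarrow> g + 0 * h) (nhds 0)" by (intro tendsto_intros filterlim_ident)
  then have "eventually (\<lambda>t. g + t * h < u) (nhds 0)"
    using False assms(1) by (intro order_tendstoD(2)) auto
  then show ?thesis by eventually_elim simp
qed (use assms in auto)

lemma eventually_affine_ge:
  fixes g :: real
  assumes "u \<le> g" "g = u \<Longrightarrow> h = 0"
  shows "eventually (\<lambda>t. u \<le> g + t * h) (nhds 0)"
proof -
  have "eventually (\<lambda>t. - g + t * - h \<le> - u) (nhds 0)"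
    using assms by (intro eventually_affine_le) auto
  then show ?thesis by eventually_elim simp
qed

text \<open>Equal small steps along \<open>d\<close> and \<open>-d\<close> stay in \<open>Q\<close>
  and have \<open>x\<close> as the midpoint of their distinct endpoints.\<close>

lemma not_extreme_point_line:
  fixes x d :: "'a::real_normed_vector"
  assumes "eventually (\<lambda>t. x + t *\<^sub>R d \<in> Q) (nhds 0)" "d \<noteq> 0"
  shows "\<not> x extreme_point_of Q"
proof
  assume x: "x extreme_point_of Q"
  obtain s where s: "s > 0" "\<And>t. \<bar>t\<bar> < s \<Longrightarrow> x + t *\<^sub>R d \<in> Q"
    using assms(1) by (auto simp: eventually_nhds_metric)
  let ?a = "x + (s / 2) *\<^sub>R d" and ?b = "x + (- (s / 2)) *\<^sub>R d"
  have "?a \<in> Q" "?b \<in> Q" using s(1) by (intro s(2); simp)+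
  moreover have "?a \<noteq> ?b" using assms(2) s(1) unfolding add_left_cancel scaleR_cancel_right by simp
  moreover have "midpoint ?a ?b = x" by (simp add: midpoint_def algebra_simps flip: scaleR_add_left)
  ultimately have "x \<in> open_segment ?a ?b" by (metis midpoint_in_open_segment)
  then show False using x \<open>?a \<in> Q\<close> \<open>?b \<in> Q\<close> by (auto simp: extreme_point_of_def)
qed

section \<open>Rank of the tight constraints at an extreme point\<close>

text \<open>A nonzero \<open>d\<close> would allow small steps both ways: tight constraints are
  constant along \<open>d\<close>, slack ones tolerate the step, the limits 0 and 1 are slack on
  \<open>F\<close>, and coordinates outside \<open>F\<close> do not move.\<close>

lemma extreme_point_residual_rigid:
  fixes d :: "real ^ 'e::finite"
  assumes x: "x extreme_point_of residual r1 r2 E b F P J" and "finite J"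
    and frac: "\<And>e. e \<in> F \<Longrightarrow> 0 < x $ e \<and> x $ e < 1" and disj: "F \<inter> P = {}"
    and off: "\<And>e. e \<notin> F \<Longrightarrow> d $ e = 0"
    and r1: "\<And>S. weight x S = of_int (r1 S) \<Longrightarrow> weight d S = 0"
    and r2: "\<And>S. weight x S = of_int (r2 S) \<Longrightarrow> weight d S = 0"
    and J: "\<And>i. i \<in> J \<Longrightarrow> weight x (E i) = of_int (b i) + real (card (E i \<inter> P)) / 2
                \<Longrightarrow> weight d (E i) = 0"
  shows "d = 0"
proof (rule ccontr)
  assume "d \<noteq> 0"
  have xQ: "x \<in> residual r1 r2 E b F P J" using x by (simp add: extreme_point_of_def)
  have "eventually (\<lambda>t. x + t *\<^sub>R d \<in> residual r1 r2 E b F P J) (nhds 0)"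
    unfolding residual_def covers_alt mem_Collect_eq weight_add_scaleR
  proof (intro eventually_conj eventually_all_finite eventually_ball_finite ballI \<open>finite J\<close>)
    show "eventually (\<lambda>t. of_int (r1 S) \<le> weight x S + t * weight d S) (nhds 0)" for S
      using xQ r1 by (intro eventually_affine_ge) (auto simp: residual_def covers_alt)
    show "eventually (\<lambda>t. of_int (r2 S) \<le> weight x S + t * weight d S) (nhds 0)" for S
      using xQ r2 by (intro eventually_affine_ge) (auto simp: residual_def covers_alt)
    show "eventually (\<lambda>t. weight x (E i) + t * weight d (E i) \<le>
        of_int (b i) + real (card (E i \<inter> P)) / 2) (nhds 0)" if "i \<in> J" for i
      using xQ J that by (intro eventually_affine_le) (auto simp: residual_def)
    show "eventually (\<lambda>t. 0 \<le> (x + t *\<^sub>R d) $ e) (nhds 0)" for e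
      using eventually_affine_ge[of 0 "x $ e" "d $ e"] xQ frac[of e] off[of e]
      by (cases "e \<in> F") (auto simp: residual_def)
    show "eventually (\<lambda>t. (x + t *\<^sub>R d) $ e \<le> 1) (nhds 0)" for e
      using eventually_affine_le[of "x $ e" 1 "d $ e"] xQ frac[of e] off[of e]
      by (cases "e \<in> F") (auto simp: residual_def)
    show "eventually (\<lambda>t. (x + t *\<^sub>R d) $ e = 1) (nhds 0)" if "e \<in> P" for e
    proof -
      have "x $ e = 1" "d $ e = 0" using that xQ off[of e] disj by (auto simp: residual_def)
      then show ?thesis by simp
    qed
    show "eventually (\<lambda>t. e \<notin> F \<union> P \<longrightarrow> (x + t *\<^sub>R d) $ e = 0) (nhds 0)" for e
      using xQ off[of e] by (auto simp: residual_def)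
  qed (auto)
  then show False using not_extreme_point_line \<open>d \<noteq> 0\<close> x by blast
qed

text \<open>By rigidity the generators of the tight covering constraints, the tight bounds and the
  unit vectors outside \<open>F\<close> together span the space. Hence they number at least
  \<open>CARD('e)\<close>; cancelling the unit vectors leaves a bound on
  \<open>card F\<close>.\<close>

lemma extreme_point_residual_card:
  fixes x :: "real ^ 'e::finite"
  assumes x: "x extreme_point_of residual r1 r2 E b F P J" and "finite J"
    and r: "supermodular r1" "supermodular r2"
    and frac: "\<And>e. e \<in> F \<Longrightarrow> 0 < x $ e \<and> x $ e < 1" and disj: "F \<inter> P = {}" and "F \<noteq> {}"
  shows "real (card F) < 2 * weight x F +
    card {i \<in> J. weight x (E i) = of_int (b i) + real (card (E i \<inter> P)) / 2}"
proof -
  let ?J = "{i \<in> J. weight x (E i) = of_int (b i) + real (card (E i \<inter> P)) / 2}"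
  have xQ: "x \<in> residual r1 r2 E b F P J" using x by (simp add: extreme_point_of_def)
  have cov: "of_int (r1 S) \<le> weight x S" "of_int (r2 S) \<le> weight x S" for S
    using xQ by (auto simp: residual_def covers_alt)
  have P: "\<And>e. e \<in> P \<Longrightarrow> x $ e = 1" and off: "\<And>e. e \<notin> F \<union> P \<Longrightarrow> x $ e = 0"
    using xQ by (auto simp: residual_def)
  have pos: "\<And>e. e \<in> F \<Longrightarrow> 0 < x $ e" using frac by auto
  obtain U1 C1 where 1: "U1 \<subseteq> F" "real (card C1) \<le> weight x U1" "U1 \<noteq> {} \<longrightarrow> U1 \<in> C1"
    "\<forall>S. weight x S = of_int (r1 S) \<longrightarrow> ind_vec (S \<inter> F) \<in> span (ind_vec ` C1)"
    using tight_span[OF r(1) cov(1) P off disj pos] by blast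
  obtain U2 C2 where 2: "U2 \<subseteq> F" "real (card C2) \<le> weight x U2" "U2 \<noteq> {} \<longrightarrow> U2 \<in> C2"
    "\<forall>S. weight x S = of_int (r2 S) \<longrightarrow> ind_vec (S \<inter> F) \<in> span (ind_vec ` C2)"
    using tight_span[OF r(2) cov(2) P off disj pos] by blast
  \<comment> \<open>The strict inequality comes from here: if both lattices reach the top set \<open>F\<close>, it is counted
    only once.\<close>
  have C12: "real (card (C1 \<union> C2)) < 2 * weight x F"
  proof (cases "U1 = F \<and> U2 = F")
    case True
    then have "C1 \<inter> C2 \<noteq> {}" using 1(3) 2(3) \<open>F \<noteq> {}\<close> by auto
    then have "card (C1 \<inter> C2) > 0" by (simp add: card_gt_0_iff)
    then have "card (C1 \<union> C2) < card C1 + card C2"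
      using card_Un_Int[of C1 C2] by simp
    then have "real (card (C1 \<union> C2)) < real (card C1) + real (card C2)" by linarith
    then show ?thesis using 1(2) 2(2) True by simp
  next
    case False
    have le: "weight x U1 \<le> weight x F" "weight x U2 \<le> weight x F"
      using 1(1) 2(1) pos by (auto intro!: weight_mono simp: less_imp_le)
    \<comment> \<open>A top set that misses an element of \<open>F\<close> also misses its positive
      weight.\<close>
    have "weight x U1 < weight x F \<or> weight x U2 < weight x F"
      using False 1(1) 2(1) pos weight_strict_mono[of _ F x] by blast
    then show ?thesis using le 1(2) 2(2) card_Un_le[of C1 C2] by linarith
  qed
  \<comment> \<open>Traces on \<open>F\<close> suffice: a direction orthogonal to the unit vectors
    outside \<open>F\<close> vanishes there, so its weight on \<open>S\<close> is its weight on
    \<open>S \<inter> F\<close>.\<close>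
  let ?B = "ind_vec ` (C1 \<union> C2) \<union> (\<lambda>i. ind_vec (E i \<inter> F)) ` ?J \<union> (\<lambda>e. axis e 1) ` (-F)
    :: (real ^ 'e) set"
  have "dim ?B \<ge> CARD('e)"
  proof (rule ccontr)
    assume "\<not> dim ?B \<ge> CARD('e)"
    then have "dim ?B < DIM(real ^ 'e)" by simp
    then obtain d where d: "d \<noteq> 0" "\<And>y. y \<in> span ?B \<Longrightarrow> orthogonal d y"
      using orthogonal_to_subspace_exists[of ?B] by blast
    have doff: "d $ e = 0" if "e \<notin> F" for e
      using d(2)[OF span_base, of "axis e 1"] that by (auto simp: orthogonal_def inner_axis)
    have dS: "weight d S = 0" if "ind_vec (S \<inter> F) \<in> span ?B" for S
      using d(2)[OF that] doff by (simp add: orthogonal_def inner_ind_vec weight_Int_support)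
    have sub: "span (ind_vec ` C1) \<subseteq> span ?B" "span (ind_vec ` C2) \<subseteq> span ?B"
      by (intro span_mono; blast)+
    have "d = 0"
    proof (rule extreme_point_residual_rigid[OF x \<open>finite J\<close> frac disj doff])
      show "weight d S = 0" if "weight x S = of_int (r1 S)" for S
        using that 1(4) sub by (intro dS) auto
      show "weight d S = 0" if "weight x S = of_int (r2 S)" for S
        using that 2(4) sub by (intro dS) auto
      show "weight d (E i) = 0"
        if "i \<in> J" "weight x (E i) = of_int (b i) + real (card (E i \<inter> P)) / 2" for i
        using that by (intro dS span_base) auto
    qed auto
    then show False using d(1) by simp
  qed
  also have "dim ?B \<le> card ?B" using \<open>finite J\<close> by (intro dim_le_card') auto
  also have "\<dots> \<le> card (C1 \<union> C2) + card ?J + card (-F)"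
  proof -
    have "card (ind_vec ` (C1 \<union> C2) :: (real ^ 'e) set) \<le> card (C1 \<union> C2)"
      "card ((\<lambda>i. ind_vec (E i \<inter> F) :: real ^ 'e) ` ?J) \<le> card ?J"
      "card ((\<lambda>e. axis e 1 :: real ^ 'e) ` (-F)) \<le> card (-F)"
      using \<open>finite J\<close> by (auto intro!: card_image_le)
    then show ?thesis
      by (meson add_mono card_Un_le order_trans)
  qed
  finally have "CARD('e) \<le> card (C1 \<union> C2) + card ?J + card (-F)" .
  moreover have "CARD('e) = card F + card (-F)"
    using card_Un_disjoint[of F "-F"] by (simp add: Compl_partition)
  ultimately show ?thesis using C12 by linarith
qed

section \<open>Finding a bound to drop\<close>

lemma card_le_max_degree:
  fixes E :: "'i \<Rightarrow> 'e::finite set"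
  assumes "finite I" "J \<subseteq> I"
  shows "card {i \<in> J. e \<in> E i} \<le> max_degree I E"
proof -
  have "card {i \<in> J. e \<in> E i} \<le> card {i \<in> I. e \<in> E i}"
    using assms by (intro card_mono) auto
  also have "\<dots> \<le> max_degree I E" unfolding max_degree_def by (intro Max_ge) auto
  finally show ?thesis .
qed

text \<open>Double counting of the slack \<open>1 - 2 * x $ e\<close> over pairs of a tight bound
  and an element of it. Values below 1/2 make every slack positive, so multiplicities can be
  replaced by their upper bound.\<close>

lemma exists_droppable_bound:
  fixes x :: "real ^ 'e::finite" and E :: "'i \<Rightarrow> 'e set"
  assumes x: "x extreme_point_of residual r1 r2 E b F P J"
    and I: "finite I" "J \<subseteq> I" "I \<noteq> {} \<Longrightarrow> max_degree I E \<ge> 1"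
    and r: "supermodular r1" "supermodular r2"
    and frac: "\<And>e. e \<in> F \<Longrightarrow> 0 < x $ e \<and> x $ e < 1/2" and disj: "F \<inter> P = {}" and "F \<noteq> {}"
  shows "\<exists>i\<in>J. int (card (E i \<inter> (F \<union> P))) < 2 * b i + int (max_degree I E)"
proof (rule ccontr)
  assume "\<not> ?thesis"
  then have no: "2 * b i + int (max_degree I E) \<le> int (card (E i \<inter> (F \<union> P)))" if "i \<in> J" for i
    using that by force
  define K where "K = {i \<in> J. weight x (E i) = of_int (b i) + real (card (E i \<inter> P)) / 2}"
  let ?D = "real (max_degree I E)"
  have "finite J" using I finite_subset by blast
  then have "finite K" by (simp add: K_def)
  have xQ: "x \<in> residual r1 r2 E b F P J" using x by (simp add: extreme_point_of_def)
  have lt: "real (card F) < 2 * weight x F + card K"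
    unfolding K_def
    by (rule extreme_point_residual_card[OF x \<open>finite J\<close> r _ disj \<open>F \<noteq> {}\<close>]) (use frac in force)
  have slack: "(\<Sum>e\<in>F. 1 - 2 * x $ e) = card F - 2 * weight x F"
    by (simp add: weight_def sum_subtractf sum_distrib_left)
  have "(\<Sum>e\<in>F. 1 - 2 * x $ e) > 0"
    using frac \<open>F \<noteq> {}\<close> by (intro sum_pos) force+
  \<comment> \<open>Positive total slack forces a tight bound to exist. Thus \<open>I\<close> is
    nonempty and the degree is positive, as the strict multiplication at the end requires.\<close>
  then have "K \<noteq> {}" using lt slack by auto
  then have D: "?D > 0" using I unfolding K_def by fastforce
  have each: "?D \<le> (\<Sum>e\<in>E i \<inter> F. 1 - 2 * x $ e)" if "i \<in> K" for i
  proof -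
    have "weight x (E i) = weight x (E i \<inter> (F \<union> P))"
      using xQ by (intro weight_Int_support[symmetric]) (auto simp: residual_def)
    also have "\<dots> = weight x (E i \<inter> F) + weight x (E i \<inter> P)"
      using weight_Un_Int[of x "E i \<inter> F" "E i \<inter> P"] disj
      by (simp add: Int_Un_distrib Int_assoc Int_left_commute)
    also have "weight x (E i \<inter> P) = real (card (E i \<inter> P))"
      using xQ by (simp add: weight_def residual_def)
    \<comment> \<open>Rounded elements weigh 1 each while the relaxed bound grants 1/2 each;
      doubling the tight equation leaves their number once on the left.\<close>
    finally have w: "2 * weight x (E i \<inter> F) + card (E i \<inter> P) = 2 * of_int (b i)"
      using that by (simp add: K_def)
    have "card (E i \<inter> (F \<union> P)) = card (E i \<inter> F) + card (E i \<inter> P)"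
      using disj by (subst Int_Un_distrib, intro card_Un_disjoint) auto
    then have "2 * b i + int (max_degree I E) \<le> int (card (E i \<inter> F)) + int (card (E i \<inter> P))"
      using no[of i] that by (simp add: K_def)
    then have "2 * of_int (b i) + ?D \<le> real (card (E i \<inter> F)) + real (card (E i \<inter> P))"
      by linarith
    then have "?D \<le> card (E i \<inter> F) - 2 * weight x (E i \<inter> F)" using w by linarith
    also have "\<dots> = (\<Sum>e\<in>E i \<inter> F. 1 - 2 * x $ e)"
      by (simp add: weight_def sum_subtractf sum_distrib_left)
    finally show ?thesis .
  qed
  have "card K * ?D \<le> (\<Sum>i\<in>K. \<Sum>e\<in>E i \<inter> F. 1 - 2 * x $ e)"
    using sum_mono[of K "\<lambda>_. ?D"] each by simp
  also have "\<dots> = (\<Sum>i\<in>K. \<Sum>e\<in>F. if e \<in> E i then 1 - 2 * x $ e else 0)"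
    by (simp add: sum.If_cases Int_commute)
  \<comment> \<open>Exchanging the sums counts the slack of an element once for each tight bound
    that contains it.\<close>
  also have "\<dots> = (\<Sum>e\<in>F. card {i \<in> K. e \<in> E i} * (1 - 2 * x $ e))"
    using \<open>finite K\<close> by (subst sum.swap) (simp add: sum.If_cases Int_def)
  also have "\<dots> \<le> (\<Sum>e\<in>F. ?D * (1 - 2 * x $ e))"
  proof (intro sum_mono mult_right_mono)
    show "real (card {i \<in> K. e \<in> E i}) \<le> ?D" for e
      using card_le_max_degree[OF I(1), of K e E] I(2) by (auto simp: K_def)
    show "0 \<le> 1 - 2 * x $ e" if "e \<in> F" for e using frac[OF that] by simp
  qed
  also have "\<dots> = ?D * (card F - 2 * weight x F)"
    by (simp only: slack flip: sum_distrib_left)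
  also have "\<dots> < ?D * card K" using lt D by (intro mult_strict_left_mono) auto
  finally show False by simp
qed

section \<open>The rounding induction\<close>

text \<open>The invariants charge rounded elements at half rate. Once \<open>F\<close> is empty the
  point is \<open>ind_vec P\<close>, and a quantity bounded by a budget plus half of itself is at
  most twice the budget; this serves both the cost and the surviving bounds. Dropped bounds are
  controlled through \<open>F \<union> P\<close>, which never grows.\<close>

lemma iterative_rounding:
  fixes E :: "'i \<Rightarrow> 'e::finite set" and c :: "real ^ 'e"
  assumes r: "supermodular r1" "supermodular r2"
    and I: "finite I" "I \<noteq> {} \<Longrightarrow> max_degree I E \<ge> 1" and c: "\<forall>e. c $ e \<ge> 0"
    and "J \<subseteq> I" and "F \<inter> P = {}"
    and "y \<in> residual r1 r2 E b F P J" and "c \<bullet> y \<le> C + weight c P / 2"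
    and "\<And>i. i \<in> I - J \<Longrightarrow> int (card (E i \<inter> (F \<union> P))) < 2 * b i + int (max_degree I E)"
  shows "\<exists>P'. covers r1 r2 (ind_vec P') \<and> weight c P' \<le> 2 * C \<and>
           (\<forall>i\<in>I. int (card (E i \<inter> P')) < 2 * b i + int (max_degree I E))"
  using assms(6-10)
proof (induction "card F + card J" arbitrary: F P J y rule: less_induct)
  case less
  let ?Q = "residual r1 r2 E b"
  let ?D = "int (max_degree I E)"
  have "finite J" using less.prems(1) I(1) finite_subset by blast
  \<comment> \<open>The point \<open>y\<close> handed over by the previous round is only known to be
    feasible, so a new extreme point is chosen at no greater cost.\<close>
  obtain x where x: "x extreme_point_of ?Q F P J" "c \<bullet> x \<le> c \<bullet> y"
    using exists_optimal_extreme_point[OF compact_convex_residual less.prems(3)] by blast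
  then have xQ: "x \<in> ?Q F P J" by (simp add: extreme_point_of_def)
  have cost: "c \<bullet> x \<le> C + weight c P / 2" using x(2) less.prems(4) by simp
  consider "F = {}" | e where "e \<in> F" "x $ e = 0" | e where "e \<in> F" "x $ e \<ge> 1/2"
    | "F \<noteq> {}" "\<And>e. e \<in> F \<Longrightarrow> 0 < x $ e \<and> x $ e < 1/2"
  proof -
    have "x $ e \<ge> 0" for e using xQ by (simp add: residual_def)
    then show ?thesis using that by (meson less_eq_real_def not_le)
  qed
  then show ?case
  proof cases
    case 1
    have xP: "x = ind_vec P" using xQ 1 by (auto simp: residual_def vec_eq_iff)
    have "int (card (E i \<inter> P)) < 2 * b i + ?D" if "i \<in> I" for i
    proof (cases "i \<in> J")
      case True
      then have "real (card (E i \<inter> P)) \<le> 2 * of_int (b i)"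
        using xQ by (auto simp: residual_def xP weight_ind_vec)
      then have "int (card (E i \<inter> P)) \<le> 2 * b i" by linarith
      \<comment> \<open>A surviving bound gives only a weak inequality against
        \<open>2 * b i\<close>; a positive degree makes it strict.\<close>
      moreover have "?D \<ge> 1" using I(2) that by auto
      ultimately show ?thesis by linarith
    next
      case False
      then show ?thesis using less.prems(5)[of i] that 1 by simp
    qed
    moreover have "weight c P \<le> 2 * C"
      using cost by (simp add: xP inner_ind_vec)
    ultimately show ?thesis using xQ xP by (auto simp: residual_def)
  next
    case (2 e)
    have mem: "x \<in> ?Q (F - {e}) P J" using xQ 2 by (auto simp: residual_def)
    have "card (F - {e}) < card F" using 2(1) by (intro psubset_card_mono) auto
    then show ?thesis
    proof (intro less.hyps[OF _ less.prems(1) _ mem cost])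
      fix i assume "i \<in> I - J"
      moreover have "card (E i \<inter> (F - {e} \<union> P)) \<le> card (E i \<inter> (F \<union> P))"
        by (intro card_mono) auto
      ultimately show "int (card (E i \<inter> (F - {e} \<union> P))) < 2 * b i + ?D"
        using less.prems(5)[of i] by linarith
    qed (use less.prems(2) in auto)
  next
    case (3 e)
    have eP: "e \<notin> P" using 3(1) less.prems(2) by auto
    have xe: "x $ e \<le> 1" using xQ by (simp add: residual_def)
    \<comment> \<open>Rounding \<open>e\<close> up adds at most 1/2 to its value. This is exactly
      what moving \<open>e\<close> into \<open>P\<close> adds to the bounds containing it and,
      multiplied by \<open>c $ e\<close>, to the cost budget.\<close>
    define z where "z = x + (1 - x $ e) *\<^sub>R axis e 1"
    have znth: "z $ a = (if a = e then 1 else x $ a)" for a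
      by (simp add: z_def axis_def)
    have waxis: "weight (axis e 1) A = (if e \<in> A then 1 else 0 :: real)" for A
      by (simp add: weight_def axis_def)
    have wz: "weight z A \<le> weight x A + (if e \<in> A then 1/2 else 0)" for A
      unfolding z_def weight_add_scaleR waxis using 3(2) by auto
    have mem: "z \<in> ?Q (F - {e}) (insert e P) J"
    proof -
      have "covers r1 r2 z"
        by (rule covers_mono[of _ _ x]) (use xQ xe in \<open>auto simp: residual_def znth\<close>)
      moreover have "weight z (E i) \<le> of_int (b i) + real (card (E i \<inter> insert e P)) / 2"
        if "i \<in> J" for i
      proof -
        have "weight x (E i) \<le> of_int (b i) + real (card (E i \<inter> P)) / 2"
          using xQ that by (simp add: residual_def)
        then show ?thesis using wz[of "E i"] eP by (auto simp: Int_insert_right add_divide_distrib)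
      qed
      ultimately show ?thesis using xQ by (auto simp: residual_def znth)
    qed
    have cz: "c \<bullet> z \<le> C + weight c (insert e P) / 2"
    proof -
      have "c \<bullet> z = c \<bullet> x + (1 - x $ e) * c $ e"
        by (simp add: z_def inner_add_right inner_axis)
      also have "(1 - x $ e) * c $ e \<le> 1/2 * c $ e"
        using 3(2) c by (intro mult_right_mono) auto
      finally show ?thesis using cost eP by (simp add: weight_def field_simps)
    qed
    have "card (F - {e}) < card F" using 3(1) by (intro psubset_card_mono) auto
    \<comment> \<open>The guarantee for dropped bounds carries over because it refers only to this
      union.\<close>
    moreover have "F - {e} \<union> insert e P = F \<union> P" using 3(1) by auto
    ultimately show ?thesis
      using less.prems(2,5) by (intro less.hyps[OF _ less.prems(1) _ mem cz]) auto
  next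
    case 4
    obtain i where i: "i \<in> J" "int (card (E i \<inter> (F \<union> P))) < 2 * b i + ?D"
      using exists_droppable_bound[OF x(1) I(1) less.prems(1) I(2) r 4(2) less.prems(2) 4(1)]
      by blast
    have mem: "x \<in> ?Q F P (J - {i})" using xQ by (auto simp: residual_def)
    have "card (J - {i}) < card J" using i(1) \<open>finite J\<close> by (intro psubset_card_mono) auto
    then show ?thesis
      using less.prems(1,5) i by (intro less.hyps[OF _ _ less.prems(2) mem cost]) auto
  qed
qed

theorem theorem3:
  fixes r1 r2 :: "'e::finite set \<Rightarrow> int"
    and c :: "real ^ 'e"
    and I :: "'i set"
    and E :: "'i \<Rightarrow> 'e set"
    and b :: "'i \<Rightarrow> int"
    and x_opt :: "real ^ 'e"
  assumes "supermodular r1" and "supermodular r2"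
    and "\<forall>e. c $ e \<ge> 0"
    and "finite I"
    and "I \<noteq> {} \<Longrightarrow> max_degree I E \<ge> 1"
    and "x_opt extreme_point_of lp_feasible r1 r2 I E b"
    and "is_arg_min (\<lambda>x. c \<bullet> x) (\<lambda>x. x \<in> lp_feasible r1 r2 I E b) x_opt"
  shows "\<exists>x_hat :: real ^ 'e.
           (\<forall>e. x_hat $ e \<in> {0, 1}) \<and>
           covers r1 r2 x_hat \<and>
           (\<forall>i\<in>I. weight x_hat (E i) \<le> 2 * of_int (b i) + of_nat (max_degree I E) - 1) \<and>
           c \<bullet> x_hat \<le> 2 * (c \<bullet> x_opt)"
proof -
  \<comment> \<open>At the start every element is free, nothing is rounded and all bounds are
    present, so the half-rate terms vanish.\<close>
  have "x_opt \<in> residual r1 r2 E b UNIV {} I"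
    using assms(6) by (auto simp: extreme_point_of_def lp_feasible_def residual_def)
  then have "\<exists>P. covers r1 r2 (ind_vec P) \<and> weight c P \<le> 2 * (c \<bullet> x_opt) \<and>
           (\<forall>i\<in>I. int (card (E i \<inter> P)) < 2 * b i + int (max_degree I E))"
    using assms(1-5) by (intro iterative_rounding[where J = I and F = UNIV and P = "{}"]) auto
  then obtain P where P: "covers r1 r2 (ind_vec P)" "weight c P \<le> 2 * (c \<bullet> x_opt)"
    "\<And>i. i \<in> I \<Longrightarrow> int (card (E i \<inter> P)) < 2 * b i + int (max_degree I E)"
    by blast
  \<comment> \<open>The \<open>- 1\<close> comes from a strict inequality between integers.\<close>
  have "weight (ind_vec P) (E i) \<le> 2 * of_int (b i) + of_nat (max_degree I E) - 1"
    if "i \<in> I" for i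
    using P(3)[OF that] unfolding weight_ind_vec by linarith
  then show ?thesis
    using P by (intro exI[of _ "ind_vec P"]) (auto simp: inner_ind_vec)
qed

end
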